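(* Let $n > 3$. In every convex Diophantine $n$-gon, the length of each side and of each diagonal is greater than $1$.
   Context: An $n$-gon is a non-degenerate polygon in the Euclidean plane with $n$ vertices. It is called Diophantine if the lengths of all its sides and all its diagonals are natural numbers (positive integers). *)

theory Defs
  imports "HOL-Analysis.Analysis"
begin

text \<open>
  A polygon in the Euclidean plane is given by the list of its vertices in cyclic order; indices
  are read modulo the length of the list.
\<close>

fun polygonal_path :: "(real ^ 2) list \<Rightarrow> real \<Rightarrow> real ^ 2" where
  "polygonal_path [] = linepath 0 0"
| "polygonal_path [a] = linepath a a"
| "polygonal_path [a, b] = linepath a b"
| "polygonal_path (a # b # c # vs) = linepath a b +++ polygonal_path (b # c # vs)"

definition polygon_boundary :: "(real ^ 2) list \<Rightarrow> (real ^ 2) set" where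
  "polygon_boundary vs = path_image (polygonal_path (vs @ [hd vs]))"

text \<open>
  The closed polygonal path has to be simple: the vertices are then distinct, and two sides meet
  at most in a common end point. Non-degeneracy means that every vertex is a genuine corner: no
  vertex is collinear with its two neighbours. Without it, vertices with a straight angle would
  be admitted: the triangle with sides \<open>2, 4, 4\<close> (apex \<open>A\<close> with \<open>AB = 4\<close>, \<open>AC = 2\<close>, \<open>BC = 4\<close>),
  with the point \<open>D\<close> of \<open>BC\<close> such that \<open>BD = 3\<close> added as a fourth vertex, has \<open>AD = 2\<close> and
  \<open>DC = 1\<close>.
\<close>

definition ngon :: "nat \<Rightarrow> (real ^ 2) list \<Rightarrow> bool" where
  "ngon n vs \<longleftrightarrow>
     n \<ge> 3 \<and> length vs = n \<and> simple_path (polygonal_path (vs @ [hd vs])) \<and>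
     (\<forall>i<n. \<not> collinear {vs ! i, vs ! (Suc i mod n), vs ! (Suc (Suc i) mod n)})"

definition polygon_region :: "(real ^ 2) list \<Rightarrow> (real ^ 2) set" where
  "polygon_region vs = polygon_boundary vs \<union> inside (polygon_boundary vs)"

definition convex_polygon :: "(real ^ 2) list \<Rightarrow> bool" where
  "convex_polygon vs \<longleftrightarrow> convex (polygon_region vs)"

definition sides :: "(real ^ 2) list \<Rightarrow> ((real ^ 2) \<times> (real ^ 2)) set" where
  "sides vs = {(vs ! i, vs ! (Suc i mod length vs)) | i. i < length vs}"

definition diagonals :: "(real ^ 2) list \<Rightarrow> ((real ^ 2) \<times> (real ^ 2)) set" where
  "diagonals vs =
     {(vs ! i, vs ! j) | i j. i < length vs \<and> j < length vs \<and> i \<noteq> j \<and>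
        j \<noteq> Suc i mod length vs \<and> i \<noteq> Suc j mod length vs}"

definition diophantine :: "(real ^ 2) list \<Rightarrow> bool" where
  "diophantine vs \<longleftrightarrow>
     (\<forall>(a, b) \<in> sides vs \<union> diagonals vs. \<exists>k::nat. k > 0 \<and> dist a b = real k)"

end

theory Submission imports Defs begin

text \<open>
  Suppose that two vertices \<open>A\<close> and \<open>B\<close> are at distance \<open>1\<close>. A vertex \<open>C\<close> off the line \<open>AB\<close> has
  \<open>\<bar>CA - CB\<bar> < 1\<close> by the strict triangle inequality, so that \<open>CA = CB\<close>, because both are integers:
  \<open>C\<close> lies on the perpendicular bisector of \<open>AB\<close> (\<open>unit_base_isosceles\<close>).

  There cannot be two such vertices \<open>C\<close>, \<open>D\<close>. Measured along the bisector from the line \<open>AB\<close>, let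
  their signed heights be \<open>x\<close> and \<open>y\<close>, and let \<open>p = CA\<close>, \<open>q = DA\<close>, \<open>k = CD\<close>. Then \<open>x - y = \<plusminus>k\<close> is a
  nonzero integer and \<open>x\<^sup>2 - y\<^sup>2 = p\<^sup>2 - q\<^sup>2\<close> is an integer, so that \<open>x + y\<close> and \<open>x\<close> are rational.
  Hence \<open>4 p\<^sup>2 - 1 = (2 x)\<^sup>2\<close> is the square of a rational number and therefore of an integer, which is
  impossible modulo \<open>4\<close> (\<open>unit_base_apexes_not_integral\<close>).

  So all vertices except at most one lie on the line \<open>AB\<close>. If there are at least four vertices,
  then the three that follow the exceptional one in the cyclic order are distinct from it, hence
  collinear, and the middle one is not a genuine corner.
\<close>

lemma unit_base_isosceles:
  fixes A B C :: "'a::euclidean_space" and p q :: nat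
  assumes AB: "dist A B = 1" and "\<not> collinear {A, B, C}"
    and p: "dist A C = real p" and q: "dist B C = real q"
  shows "p = q"
proof -
  have "\<not> between (A, C) B" "\<not> between (B, C) A"
    using assms(2) between_imp_collinear[of A C B] between_imp_collinear[of B C A]
    by (auto simp: insert_commute)
  then have "dist A C \<noteq> dist A B + dist B C" "dist B C \<noteq> dist B A + dist A C"
    by (auto simp: between)
  moreover have "dist A C \<le> dist A B + dist B C" "dist B C \<le> dist B A + dist A C"
    by (rule dist_triangle)+
  ultimately have "real p < 1 + real q" "real q < 1 + real p"
    using AB p q by (auto simp: dist_commute)
  then show ?thesis by linarith
qed

text \<open>
  The vectors orthogonal to \<open>u \<noteq> 0\<close> form a line of the plane, and on a line the Cauchy--Schwarz
  inequality is an equality.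
\<close>

lemma orthogonal_plane_inner_square:
  fixes u x y :: "real ^ 2"
  assumes "u \<noteq> 0" and xu: "x \<bullet> u = 0" and yu: "y \<bullet> u = 0"
  shows "(x \<bullet> y)\<^sup>2 = (x \<bullet> x) * (y \<bullet> y)"
proof -
  have x: "x$1 * u$1 + x$2 * u$2 = 0" and y: "y$1 * u$1 + y$2 * u$2 = 0"
    using xu yu by (simp_all add: inner_vec_def sum_2)
  have "u$1 * (x$1 * y$2 - x$2 * y$1) = 0" "u$2 * (x$1 * y$2 - x$2 * y$1) = 0"
    using x y by algebra+
  moreover have "u$1 \<noteq> 0 \<or> u$2 \<noteq> 0"
    using \<open>u \<noteq> 0\<close> by (auto simp: vec_eq_iff forall_2)
  ultimately have "x$1 * y$2 - x$2 * y$1 = 0" by auto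
  then show ?thesis
    by (simp add: inner_vec_def sum_2) algebra
qed

lemma four_square_minus_one_not_square:
  fixes p r :: int
  shows "4 * p\<^sup>2 - 1 \<noteq> r\<^sup>2"
proof
  assume r: "4 * p\<^sup>2 - 1 = r\<^sup>2"
  show False
  proof (cases "even r")
    case True
    then obtain s where "r = 2 * s" by blast
    with r have "4 * p\<^sup>2 - 1 = 4 * s\<^sup>2" by (simp add: power_mult_distrib)
    then show False by presburger
  next
    case False
    then obtain s where "r = 2 * s + 1" by (rule oddE)
    with r have "4 * p\<^sup>2 - 1 = 4 * (s\<^sup>2 + s) + 1" by (simp add: power2_eq_square algebra_simps)
    then show False by presburger
  qed
qed

text \<open>
  The equation \<open>k\<^sup>2 (4 p\<^sup>2 - 1) = (k\<^sup>2 + p\<^sup>2 - q\<^sup>2)\<^sup>2\<close> below is the rationality of the height of \<open>C\<close> with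
  denominators cleared. It is obtained from inner products with respect to the midpoint of \<open>AB\<close>,
  so that the position of \<open>C\<close> and \<open>D\<close> on the same or on different sides of \<open>AB\<close> does not matter.
\<close>

lemma unit_base_apexes_not_integral:
  fixes A B C D :: "real ^ 2" and p q k :: nat
  assumes AB: "dist A B = 1"
    and C: "dist A C = real p" "dist B C = real p"
    and D: "dist A D = real q" "dist B D = real q"
    and CD: "dist C D = real k" and "k > 0"
  shows False
proof -
  define u where "u = (1/2) *\<^sub>R (B - A)"
  define M where "M = (1/2) *\<^sub>R (A + B)"
  define x where "x = C - M"
  define y where "y = D - M"
  have vecs: "C - A = x + u" "C - B = x - u" "D - A = y + u" "D - B = y - u" "C - D = x - y"
    "B - A = 2 *\<^sub>R u"
    by (simp_all add: u_def M_def x_def y_def vec_eq_iff field_simps)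
  have sq: "(dist P Q)\<^sup>2 = (Q - P) \<bullet> (Q - P)" for P Q :: "real ^ 2"
    by (metis dist_commute dist_norm power2_norm_eq_inner)
  have uu: "u \<bullet> u = 1/4"
    using sq[of A B] AB vecs by simp
  then have "u \<noteq> 0" by auto
  have xp: "x \<bullet> x + 2 * (x \<bullet> u) + u \<bullet> u = (real p)\<^sup>2" "x \<bullet> x - 2 * (x \<bullet> u) + u \<bullet> u = (real p)\<^sup>2"
    using sq[of A C] sq[of B C] C vecs by (simp_all add: inner_simps inner_commute)
  have yq: "y \<bullet> y + 2 * (y \<bullet> u) + u \<bullet> u = (real q)\<^sup>2" "y \<bullet> y - 2 * (y \<bullet> u) + u \<bullet> u = (real q)\<^sup>2"
    using sq[of A D] sq[of B D] D vecs by (simp_all add: inner_simps inner_commute)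
  have k: "x \<bullet> x - 2 * (x \<bullet> y) + y \<bullet> y = (real k)\<^sup>2"
    using sq[of D C] CD vecs by (simp add: inner_simps inner_commute dist_commute)
  have xu: "x \<bullet> u = 0" and yu: "y \<bullet> u = 0" using xp yq by auto
  have X: "x \<bullet> x = (real p)\<^sup>2 - 1/4" and Y: "y \<bullet> y = (real q)\<^sup>2 - 1/4"
    using xp yq xu yu uu by auto
  have "(2 * (x \<bullet> y))\<^sup>2 = 4 * (x \<bullet> x) * (y \<bullet> y)"
    using orthogonal_plane_inner_square[OF \<open>u \<noteq> 0\<close> xu yu] by (simp add: power_mult_distrib)
  moreover have "2 * (x \<bullet> y) = x \<bullet> x + y \<bullet> y - (real k)\<^sup>2" using k by simp
  ultimately have "(x \<bullet> x + y \<bullet> y - (real k)\<^sup>2)\<^sup>2 = 4 * (x \<bullet> x) * (y \<bullet> y)" by simp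
  then have "4 * (real k)\<^sup>2 * (x \<bullet> x) = ((real k)\<^sup>2 + x \<bullet> x - y \<bullet> y)\<^sup>2" by algebra
  then have "(real k)\<^sup>2 * (4 * (real p)\<^sup>2 - 1) = ((real k)\<^sup>2 + (real p)\<^sup>2 - (real q)\<^sup>2)\<^sup>2"
    unfolding X Y by (simp add: algebra_simps)
  then have "real_of_int ((int k)\<^sup>2 * (4 * (int p)\<^sup>2 - 1))
      = real_of_int (((int k)\<^sup>2 + (int p)\<^sup>2 - (int q)\<^sup>2)\<^sup>2)"
    by simp
  then have eq: "(int k)\<^sup>2 * (4 * (int p)\<^sup>2 - 1) = ((int k)\<^sup>2 + (int p)\<^sup>2 - (int q)\<^sup>2)\<^sup>2"
    by (simp only: of_int_eq_iff)
  then have "(int k)\<^sup>2 dvd ((int k)\<^sup>2 + (int p)\<^sup>2 - (int q)\<^sup>2)\<^sup>2" by (metis dvd_triv_left)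
  then have "int k dvd (int k)\<^sup>2 + (int p)\<^sup>2 - (int q)\<^sup>2" by simp
  then obtain r where "(int k)\<^sup>2 + (int p)\<^sup>2 - (int q)\<^sup>2 = int k * r" by (rule dvdE)
  with eq \<open>k > 0\<close> have "4 * (int p)\<^sup>2 - 1 = r\<^sup>2" by (simp add: power_mult_distrib)
  then show False using four_square_minus_one_not_square by blast
qed

lemma pair_in_sides_diagonals:
  assumes "i < length vs" "j < length vs" "i \<noteq> j"
  shows "(vs ! i, vs ! j) \<in> sides vs \<union> diagonals vs \<or>
    (vs ! j, vs ! i) \<in> sides vs \<union> diagonals vs"
proof -
  consider "j = Suc i mod length vs" | "i = Suc j mod length vs"
    | "j \<noteq> Suc i mod length vs" "i \<noteq> Suc j mod length vs" by blast
  then show ?thesis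
  proof cases
    case 1
    then have "(vs ! i, vs ! j) \<in> sides vs" using assms unfolding sides_def by blast
    then show ?thesis by blast
  next
    case 2
    then have "(vs ! j, vs ! i) \<in> sides vs" using assms unfolding sides_def by blast
    then show ?thesis by blast
  next
    case 3
    then have "(vs ! i, vs ! j) \<in> diagonals vs" using assms unfolding diagonals_def by blast
    then show ?thesis by blast
  qed
qed

lemma diophantine_dist:
  assumes "diophantine vs" and "i < length vs" "j < length vs" "i \<noteq> j"
  shows "\<exists>k::nat. k > 0 \<and> dist (vs ! i) (vs ! j) = real k"
proof -
  have "\<exists>k::nat. k > 0 \<and> dist a b = real k" if "(a, b) \<in> sides vs \<union> diagonals vs" for a b
    using assms(1) that unfolding diophantine_def by blast
  then show ?thesis
    using pair_in_sides_diagonals[OF assms(2-4)] by (metis dist_commute)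
qed

lemma collinear_with_line_imp_collinear:
  fixes a b :: "'a::euclidean_space"
  assumes "a \<noteq> b" "collinear {a, b, x}" "collinear {a, b, y}" "collinear {a, b, z}"
  shows "collinear {x, y, z}"
proof -
  have "{x, y, z} \<subseteq> affine hull {a, b}"
    using assms by (auto simp: collinear_3_affine_hull)
  then show ?thesis by (auto simp: collinear_affine_hull)
qed

theorem theorem1:
  fixes n :: nat and vs :: "(real ^ 2) list"
  assumes "n > 3"
    and "ngon n vs"
    and "convex_polygon vs"
    and "diophantine vs"
  shows "\<forall>(a, b) \<in> sides vs \<union> diagonals vs. dist a b > 1"
proof (rule ccontr)
  assume "\<not> ?thesis"
  then obtain a b where ab: "(a, b) \<in> sides vs \<union> diagonals vs" and "\<not> dist a b > 1" by auto
  have len: "length vs = n"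
    and corner: "\<And>i. i < n \<Longrightarrow>
      \<not> collinear {vs ! i, vs ! (Suc i mod n), vs ! (Suc (Suc i) mod n)}"
    using \<open>ngon n vs\<close> by (auto simp: ngon_def)
  have dioph: "\<exists>k::nat. k > 0 \<and> dist (vs ! i) (vs ! j) = real k" if "i < n" "j < n" "i \<noteq> j" for i j
    using diophantine_dist[OF \<open>diophantine vs\<close>] that len by simp
  obtain k :: nat where "k > 0" "dist a b = real k"
    using ab \<open>diophantine vs\<close> unfolding diophantine_def by blast
  with \<open>\<not> dist a b > 1\<close> have AB: "dist a b = 1" by simp
  then have "a \<noteq> b" by auto
  obtain i j where ij: "i < n" "j < n" "a = vs ! i" "b = vs ! j"
  proof -
    have "Suc l mod n < n" for l using \<open>n > 3\<close> by simp
    then have "a \<in> (!) vs ` {..<n} \<and> b \<in> (!) vs ` {..<n}"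
      using ab len by (auto simp: sides_def diagonals_def)
    then show ?thesis using that by blast
  qed
  have apex: "\<exists>p::nat. dist a (vs ! l) = real p \<and> dist b (vs ! l) = real p"
    if "l < n" "\<not> collinear {a, b, vs ! l}" for l
  proof -
    have "l \<noteq> i" "l \<noteq> j" using that ij by (auto simp: insert_commute)
    then obtain p q :: nat where "dist a (vs ! l) = real p" "dist b (vs ! l) = real q"
      using dioph[of i l] dioph[of j l] ij \<open>l < n\<close> by auto
    with unit_base_isosceles[OF AB that(2)] show ?thesis by auto
  qed
  have unique: "l = m"
    if l: "l < n" "\<not> collinear {a, b, vs ! l}" and m: "m < n" "\<not> collinear {a, b, vs ! m}" for l m
  proof (rule ccontr)
    assume "l \<noteq> m"
    with dioph l m obtain k :: nat where "k > 0" "dist (vs ! l) (vs ! m) = real k" by blast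
    with apex[OF l] apex[OF m] show False
      using unit_base_apexes_not_integral[OF AB] by blast
  qed
  obtain m where "m < n" and line: "\<And>l. l < n \<Longrightarrow> l \<noteq> m \<Longrightarrow> collinear {a, b, vs ! l}"
  proof (cases "\<exists>l<n. \<not> collinear {a, b, vs ! l}")
    case True
    then show ?thesis using that unique by blast
  next
    case False
    \<comment> \<open>All vertices lie on the line, and any index can play the part of the exceptional one.\<close>
    then show ?thesis using that[of 0] \<open>n > 3\<close> by auto
  qed
  define s where "s = Suc m mod n"
  have s: "s < n" "s \<noteq> m" "Suc s mod n \<noteq> m" "Suc (Suc s) mod n \<noteq> m"
    using \<open>m < n\<close> \<open>n > 3\<close> by (auto simp: s_def mod_Suc split: if_splits)
  have "collinear {vs ! s, vs ! (Suc s mod n), vs ! (Suc (Suc s) mod n)}"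
    using collinear_with_line_imp_collinear[OF \<open>a \<noteq> b\<close>] line s \<open>n > 3\<close> by simp
  with corner[OF s(1)] show False by contradiction
qed

end
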